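(* Let $F$ be a field, let $A\in F^{n\times n}$, and let $\lambda\in F$ with $\lambda\notin\{0,1\}$. Let $k_0=\dim\{v\in F^n\mid vA=0\}$ and $m_0=\dim\{v\in F^n\mid vA^n=0\}$. If $k_0+m_0/2\leq n$, then $\dim_F C_F(A,\lambda)\leq n^2/2$. In particular, $\dim_F C_F(A,\lambda)\leq n^2/2$ holds for invertible matrices $A$.
   Context: For a field $F$, $A\in F^{n\times n}$ and $\lambda\in F$, $C_F(A,\lambda)=\{B\in F^{n\times n}\mid AB-\lambda BA=0\}$. Elements of $F^n$ are row vectors and matrices act on the right. *)

theory Defs
  imports Jordan_Normal_Form.Matrix_Kernel
begin

text \<open>
  A vector of type \<^typ>\<open>'a vec\<close> carries no orientation. Here it is read as a row vector, with
  matrices acting from the right; \<open>*\<^sub>v\<close> would be the action on column vectors.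
\<close>

definition row_mult :: "'a :: semiring_0 vec \<Rightarrow> 'a mat \<Rightarrow> 'a vec" where
  "row_mult v A = vec (dim_col A) (\<lambda>j. v \<bullet> col A j)"

definition left_kernel :: "nat \<Rightarrow> 'a :: field mat \<Rightarrow> 'a vec set" where
  "left_kernel n A = {v \<in> carrier_vec n. row_mult v A = 0\<^sub>v n}"

definition skew_centralizer :: "nat \<Rightarrow> 'a :: field mat \<Rightarrow> 'a \<Rightarrow> 'a mat set" where
  "skew_centralizer n A c = {B \<in> carrier_mat n n. A * B - c \<cdot>\<^sub>m (B * A) = 0\<^sub>m n n}"

text \<open>
  The dimensions over the ground field of subspaces of the space of vectors of length \<open>n\<close> and of
  \<open>n \<times> n\<close> matrices. As \<open>vectorspace.dim\<close> is only meaningful for vector spaces, these are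
  meant to be applied to subspaces only.
\<close>

definition vec_subspace_dim :: "nat \<Rightarrow> 'a :: field vec set \<Rightarrow> nat" where
  "vec_subspace_dim n W =
    vectorspace.dim class_ring (module_vec TYPE('a) n\<lparr>carrier := W\<rparr>)"

definition mat_subspace_dim :: "nat \<Rightarrow> 'a :: field mat set \<Rightarrow> nat" where
  "mat_subspace_dim n W =
    vectorspace.dim class_ring (module_mat TYPE('a) n n\<lparr>carrier := W\<rparr>)"

lemma row_mult_transpose: "row_mult v A = A\<^sup>T *\<^sub>v v"
  if "v \<in> carrier_vec (dim_row A)" for v :: "'a :: comm_semiring_0 vec"
  unfolding row_mult_def mult_mat_vec_def using that
  by (auto intro!: eq_vecI comm_scalar_prod[where n = "dim_row A"])

lemma left_kernel_eq_mat_kernel: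
  assumes "A \<in> carrier_mat n n"
  shows "left_kernel n A = mat_kernel A\<^sup>T"
  using assms unfolding left_kernel_def mat_kernel_def
  by (auto simp: row_mult_transpose)

lemma left_kernel_subspace:
  assumes A: "(A :: 'a :: field mat) \<in> carrier_mat n n"
  shows "subspace class_ring (left_kernel n A) (module_vec TYPE('a) n)"
proof -
  interpret vec_space "TYPE('a)" n .
  have A': "A\<^sup>T \<in> carrier_mat n n" using A by simp
  have zero: "A\<^sup>T *\<^sub>v 0\<^sub>v n = 0\<^sub>v n"
    using A by (intro eq_vecI) (auto intro!: scalar_prod_right_zero)
  show ?thesis
    unfolding left_kernel_eq_mat_kernel[OF A] subspace_def submodule_def mat_kernel[OF A']
    using vectorspace_axioms module_axioms
      mult_add_distrib_mat_vec[OF A'] mult_mat_vec[OF A'] zero A'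
    by (simp add: module_vec_simps subset_iff)
qed

lemma skew_centralizer_subspace:
  assumes A: "(A :: 'a :: field mat) \<in> carrier_mat n n"
  shows "subspace class_ring (skew_centralizer n A c) (module_mat TYPE('a) n n)"
proof -
  interpret vectorspace class_ring "module_mat TYPE('a) n n" by (rule matrix_vs)
  have eq: "B \<in> skew_centralizer n A c \<longleftrightarrow>
      B \<in> carrier_mat n n \<and> A * B = c \<cdot>\<^sub>m (B * A)" for B
  proof -
    have minus: "X - Y = 0\<^sub>m n n \<longleftrightarrow> X = Y"
      if "X \<in> carrier_mat n n" "Y \<in> carrier_mat n n" for X Y :: "'a mat"
      using that by (simp add: mat_eq_iff)
    have "A * B \<in> carrier_mat n n" "c \<cdot>\<^sub>m (B * A) \<in> carrier_mat n n"
      if "B \<in> carrier_mat n n"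
      using A that by simp_all
    then show ?thesis
      unfolding skew_centralizer_def mem_Collect_eq by (intro conj_cong refl minus)
  qed
  have add: "X + Y \<in> skew_centralizer n A c"
    if "X \<in> skew_centralizer n A c" "Y \<in> skew_centralizer n A c" for X Y
  proof -
    have X: "X \<in> carrier_mat n n" "A * X = c \<cdot>\<^sub>m (X * A)"
      and Y: "Y \<in> carrier_mat n n" "A * Y = c \<cdot>\<^sub>m (Y * A)" using that by (auto simp: eq)
    have "A * (X + Y) = c \<cdot>\<^sub>m (X * A) + c \<cdot>\<^sub>m (Y * A)"
      using X Y by (simp add: mult_add_distrib_mat[OF A])
    also have "\<dots> = c \<cdot>\<^sub>m ((X + Y) * A)"
      using A X(1) Y(1) by (simp add: add_mult_distrib_mat[OF X(1) Y(1) A] add_smult_distrib_left_mat[where nr = n and nc = n])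
    finally show ?thesis using X Y by (simp add: eq)
  qed
  have smult: "d \<cdot>\<^sub>m X \<in> skew_centralizer n A c" if "X \<in> skew_centralizer n A c" for d X
  proof -
    have X: "X \<in> carrier_mat n n" "A * X = c \<cdot>\<^sub>m (X * A)" using that by (auto simp: eq)
    have "A * (d \<cdot>\<^sub>m X) = d \<cdot>\<^sub>m (c \<cdot>\<^sub>m (X * A))"
      using X by (simp add: mult_smult_distrib[OF A X(1)])
    also have "\<dots> = c \<cdot>\<^sub>m ((d \<cdot>\<^sub>m X) * A)"
      by (auto simp: mult_smult_assoc_mat[OF X(1) A] mult_ac intro!: eq_matI)
    finally show ?thesis using X by (simp add: eq)
  qed
  show ?thesis
    unfolding subspace_def submodule_def
    using vectorspace_axioms module_axioms add smult A
    by (simp add: module_mat_simps eq subset_iff)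
qed

end

theory Submission
  imports Defs
    "HOL-Algebra.Algebraic_Closure_Type"
    "Jordan_Normal_Form.Jordan_Normal_Form_Existence"
    "Jordan_Normal_Form.Jordan_Normal_Form_Uniqueness"
    "Jordan_Normal_Form.DL_Rank"
begin

text \<open>
  Let \<open>k\<close> and \<open>m\<close> be the dimensions of the kernels of \<open>A\<close> and \<open>A\<^sup>n\<close> on row vectors. The heart of the matter is
  the bound \<open>dim C(A, c) \<le> k m + (n - m)\<^sup>2 / 2\<close>
  (\<open>skew_centralizer_dim_bound\<close>). If \<open>k \<le> n - m / 2\<close>, its right hand side is at most
  \<open>(n - m / 2) m + (n - m)\<^sup>2 / 2 = n\<^sup>2 / 2\<close>; for an invertible matrix \<open>k = 0\<close>, and \<open>m \<le> n\<close> always.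

  For the bound, the matrix \<open>B\<close> solves \<open>A B = c B A\<close> if and only if \<open>Y = B\<^sup>T\<close> solves \<open>Y M = c M Y\<close> with \<open>M = A\<^sup>T\<close>.
  Over the algebraic closure, \<open>M\<close> may be replaced by a Jordan matrix \<open>J\<close> with diagonal \<open>a\<close>.
  The equation \<open>Y J = c J Y\<close> then separates into the rectangles given by pairs of blocks. A rectangle with
  \<open>a j \<noteq> c a i\<close> is zero. In a rectangle with \<open>a i = a j = 0\<close>, the first row determines the others; since
  there are \<open>k\<close> nilpotent blocks, of total size \<open>m\<close>, this leaves \<open>k m\<close> free entries
  (\<open>jordan_skew_commuting_vanishes\<close>). What remains are the positions with \<open>a j = c a i \<noteq> 0\<close>.
  They are at most as many as those with \<open>a j = a i \<noteq> 0\<close> and, because \<open>c \<noteq> 1\<close>, disjoint from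
  them, so they fill at most half of a square with side \<open>n - m\<close> (\<open>scaled_pairs_bound\<close>).

  The dimensions in the statement are taken over the ground field. Dimensions of kernels do
  not change under field extension (\<open>kernel_dim_map_mat\<close>). For the space of solutions it is enough that matrices
  which are linearly independent over the ground field remain so over the extension
  (\<open>linear_dependence_descends\<close>): if there were more of them than free positions, some nontrivial
  combination over the extension would vanish at all free positions and hence be zero.
\<close>

section \<open>Linear systems and extension of the ground field\<close>

text \<open>
  Gaussian elimination, one equation at a time: an unknown with a nonzero coefficient in the equation
  \<open>s\<close> is solved for and substituted into the others, which costs one equation and one unknown.
\<close>

lemma underdetermined_system_nontrivial_solution:
  fixes f :: "'b \<Rightarrow> 's \<Rightarrow> 'k :: field"
  assumes "finite S" "finite B" "card S < card B"
  shows "\<exists>x. (\<exists>b\<in>B. x b \<noteq> 0) \<and> (\<forall>s\<in>S. (\<Sum>b\<in>B. x b * f b s) = 0)"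
  using assms
proof (induction S arbitrary: B f rule: finite_induct)
  case empty
  then have "B \<noteq> {}" by auto
  then show ?case by (intro exI[of _ "\<lambda>_. 1"]) auto
next
  case (insert s S)
  show ?case
  proof (cases "\<forall>b\<in>B. f b s = 0")
    case True
    from insert.IH[OF insert.prems(1), of f] insert.prems insert.hyps
    obtain x where "\<exists>b\<in>B. x b \<noteq> 0" "\<forall>t\<in>S. (\<Sum>b\<in>B. x b * f b t) = 0" by auto
    with True show ?thesis by (intro exI[of _ x]) auto
  next
    case False
    then obtain p where p: "p \<in> B" "f p s \<noteq> 0" by auto
    (* The equations that remain after p has been eliminated by means of the equation s. *)
    define g where "g b t = f b t - f b s / f p s * f p t" for b t
    have "card S < card (B - {p})" using insert p by simp
    from insert.IH[OF _ this, of g] insert.prems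
    obtain x where x: "\<exists>b\<in>B - {p}. x b \<noteq> 0" "\<forall>t\<in>S. (\<Sum>b\<in>B - {p}. x b * g b t) = 0" by auto
    define y where "y = x(p := - (\<Sum>b\<in>B - {p}. x b * f b s) / f p s)"
    have y: "(\<Sum>b\<in>B. y b * f b t) = (\<Sum>b\<in>B - {p}. x b * g b t)" for t
    proof -
      have "(\<Sum>b\<in>B. y b * f b t) = y p * f p t + (\<Sum>b\<in>B - {p}. y b * f b t)"
        using p insert.prems by (simp add: sum.remove)
      also have "(\<Sum>b\<in>B - {p}. y b * f b t) = (\<Sum>b\<in>B - {p}. x b * f b t)"
        by (intro sum.cong) (auto simp: y_def)
      also have "y p * f p t = - (\<Sum>b\<in>B - {p}. x b * (f b s / f p s * f p t))"
        by (simp add: y_def sum_distrib_right sum_divide_distrib mult.assoc)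
      finally show ?thesis by (simp add: g_def right_diff_distrib sum_subtractf)
    qed
    have "g b s = 0" for b using p by (simp add: g_def)
    then have "(\<Sum>b\<in>B. y b * f b s) = 0" by (simp add: y)
    moreover have "\<exists>b\<in>B. y b \<noteq> 0" using x(1) by (auto simp: y_def)
    ultimately show ?thesis using x(2) y by (intro exI[of _ y]) auto
  qed
qed

text \<open>
  The target of a field homomorphism is a vector space over its source, so a nonzero element can be
  extended to a basis, and a linear functional can be prescribed on it.
\<close>

lemma (in field_hom) linear_functional_nonzero_at:
  assumes "z \<noteq> 0"
  shows "\<exists>\<phi>. (\<forall>x y. \<phi> (x + y) = \<phi> x + \<phi> y) \<and> (\<forall>r x. \<phi> (hom r * x) = r * \<phi> x) \<and> \<phi> z \<noteq> 0"
proof -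
  interpret vs: vector_space_pair "\<lambda>r x. hom r * x" "(*)"
    by unfold_locales (auto simp: algebra_simps hom_distribs)
  have "\<not> vs.vs1.dependent {z}" using assms by (simp add: vs.vs1.dependent_single)
  then obtain \<phi> where \<phi>: "Vector_Spaces.linear (\<lambda>r x. hom r * x) (*) \<phi>" "\<phi> z = 1"
    using vs.linear_independent_extend[of "{z}" "\<lambda>_. 1"] by auto
  interpret \<phi>: Vector_Spaces.linear "\<lambda>r x. hom r * x" "(*)" \<phi> by (rule \<phi>(1))
  show ?thesis using \<phi>(2) by (intro exI[of _ \<phi>]) (auto simp: \<phi>.add \<phi>.scale)
qed

text \<open>
  Linear dependence over an extension field is already visible over the ground field: a functional
  from the extension to the ground field turns a relation with coefficients \<open>x\<close> into one with
  coefficients \<open>\<phi> (x b)\<close>, which is nontrivial if \<open>\<phi>\<close> is chosen nonzero at \<open>x p\<close>.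
\<close>

lemma (in field_hom) linear_dependence_descends:
  assumes "\<And>s. s \<in> S \<Longrightarrow> (\<Sum>b\<in>B. x b * hom (g b s)) = 0"
    and "p \<in> B" "x p \<noteq> 0"
  shows "\<exists>y. y p \<noteq> 0 \<and> (\<forall>s\<in>S. (\<Sum>b\<in>B. y b * g b s) = 0)"
proof -
  obtain \<phi> where add: "\<And>x y. \<phi> (x + y) = \<phi> x + \<phi> y"
    and scale: "\<And>r x. \<phi> (hom r * x) = r * \<phi> x" and p: "\<phi> (x p) \<noteq> 0"
    using linear_functional_nonzero_at[OF assms(3)] by blast
  have zero: "\<phi> 0 = 0" using scale[of 0 0] by simp
  have sum: "\<phi> (sum h B) = (\<Sum>b\<in>B. \<phi> (h b))" for h
    by (induction B rule: infinite_finite_induct) (simp_all add: add zero)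
  have "(\<Sum>b\<in>B. \<phi> (x b) * g b s) = 0" if "s \<in> S" for s
  proof -
    have "(\<Sum>b\<in>B. \<phi> (x b) * g b s) = \<phi> (\<Sum>b\<in>B. x b * hom (g b s))"
      unfolding sum by (intro sum.cong refl) (metis scale mult.commute)
    then show ?thesis using assms(1)[OF that] zero by simp
  qed
  with p show ?thesis by (intro exI[of _ "\<lambda>b. \<phi> (x b)"]) auto
qed

text \<open>
  Row reduction takes place in the ground field, so the reduced row echelon form over the
  extension is the image of the one over the ground field and has the same nonzero rows.
\<close>

lemma (in field_hom) kernel_dim_map_mat: "kernel_dim (map_mat hom A) = kernel_dim A"
proof -
  define nr nc where "nr = dim_row A" and "nc = dim_col A"
  have A: "A \<in> carrier_mat nr nc" by (simp add: nr_def nc_def)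
  let ?h = "map_mat hom" and ?R = "gauss_jordan_single A"
  from gauss_jordan_single[OF A refl] obtain P Q where R: "?R = P * A" and QP: "Q * P = 1\<^sub>m nr"
    and P: "P \<in> carrier_mat nr nr" and Q: "Q \<in> carrier_mat nr nr"
    and Rc: "?R \<in> carrier_mat nr nc" and ref: "row_echelon_form ?R" by auto
  have hR: "?h ?R = ?h P * ?h A" using mat_hom_mult[OF P A] R by simp
  have hQP: "?h Q * ?h P = 1\<^sub>m nr" using mat_hom_mult[OF Q P] QP mat_hom_one[of nr] by metis
  from ref Rc obtain p where piv: "pivot_fun ?R p nc" by (auto simp: row_echelon_form_def)
  have "pivot_fun (?h ?R) p nc"
    using Rc piv unfolding pivot_fun_def by (auto simp: Let_def)
  then have href: "row_echelon_form (?h ?R)" using Rc by (auto simp: row_echelon_form_def)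
  have row: "row (?h ?R) i \<noteq> 0\<^sub>v nc \<longleftrightarrow> row ?R i \<noteq> 0\<^sub>v nc" if "i < nr" for i
    using Rc that by (auto simp: vec_eq_iff)
  have "kernel.dim nc A = kernel.dim nc ?R"
    unfolding R using mat_kernel_mult_eq[OF A P Q QP] by simp
  also have "\<dots> = nc - card {i. i < nr \<and> row ?R i \<noteq> 0\<^sub>v nc}"
    by (rule find_base_vectors(6)[OF ref Rc])
  also have "\<dots> = nc - card {i. i < nr \<and> row (?h ?R) i \<noteq> 0\<^sub>v nc}"
    using row by (metis (no_types, lifting))
  also have "\<dots> = kernel.dim nc (?h ?R)"
    using find_base_vectors(6)[OF href, of nr nc] Rc by simp
  also have "\<dots> = kernel.dim nc (?h A)"
    unfolding hR using mat_kernel_mult_eq[of "?h A" nr nc "?h P" "?h Q"] A P Q hQP by simp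
  finally show ?thesis by (simp add: kernel_dim_def nc_def)
qed

section \<open>Dimensions of subspaces\<close>

text \<open>
  As \<open>dim\<close> is the least size of a finite generating set, finite dimension has to be part of the
  argument: the bound on independent sets yields a maximal one, which is a basis.
\<close>

lemma (in vectorspace) dim_le_of_lin_indpt_bound:
  assumes "\<And>B. B \<subseteq> carrier V \<Longrightarrow> finite B \<Longrightarrow> lin_indpt B \<Longrightarrow> card B \<le> N"
  shows "dim \<le> N"
proof -
  let ?P = "\<lambda>B. B \<subseteq> carrier V \<and> lin_indpt B"
  have bound: "finite B \<and> card B \<le> N" if "?P B" for B
  proof -
    have "card C \<le> N" if "C \<subseteq> B" "finite C" for C
      using that \<open>?P B\<close> subset_li_is_li[of B C] by (intro assms) auto
    then have "finite B" by (metis finite_if_finite_subsets_card_bdd)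
    with \<open>?P B\<close> assms show ?thesis by auto
  qed
  have "?P {}" by (auto simp: lin_dep_def)
  from maximal_exists[of ?P, OF bound this] obtain B where B: "finite B" "maximal B ?P" by auto
  then have "dim = card B" using dim_basis max_li_is_basis by blast
  also have "\<dots> \<le> N" using B bound by (auto simp: maximal_def)
  finally show ?thesis .
qed

text \<open>
  This reduces a bound on the dimension of a space of matrices to statements about sums of entries.
\<close>

lemma mat_subspace_dim_le:
  fixes W :: "'a :: field mat set"
  assumes sub: "VectorSpace.subspace class_ring W (module_mat TYPE('a) n n)"
    and bound: "\<And>B. finite B \<Longrightarrow> B \<subseteq> W \<Longrightarrow>
      (\<And>y. \<forall>i<n. \<forall>j<n. (\<Sum>b\<in>B. y b * b $$ (i,j)) = 0 \<Longrightarrow> \<forall>b\<in>B. y b = 0) \<Longrightarrow> card B \<le> N"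
  shows "mat_subspace_dim n W \<le> N"
proof -
  let ?M = "module_mat TYPE('a) n n"
  interpret M: vectorspace class_ring ?M by (rule matrix_vs)
  interpret W: vectorspace class_ring "?M\<lparr>carrier := W\<rparr>"
    using M.subspace_is_vs[OF sub] by simp
  have W: "W \<subseteq> carrier_mat n n"
    using submodule.subset[OF subspace.submod[OF sub]] by (simp add: module_mat_simps)
  show ?thesis unfolding mat_subspace_dim_def
  proof (rule W.dim_le_of_lin_indpt_bound)
    fix B assume B: "B \<subseteq> carrier (?M\<lparr>carrier := W\<rparr>)" "finite B" "W.lin_indpt B"
    then have BW: "B \<subseteq> W" by simp
    show "card B \<le> N"
    proof (rule bound[OF B(2) BW], rule ballI, rule ccontr)
      fix y b assume y: "\<forall>i<n. \<forall>j<n. (\<Sum>b\<in>B. y b * b $$ (i,j)) = 0" and b: "b \<in> B" "y b \<noteq> 0"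
      have lc: "W.lincomb y C \<in> carrier_mat n n \<and>
          (\<forall>i<n. \<forall>j<n. W.lincomb y C $$ (i,j) = (\<Sum>b\<in>C. y b * b $$ (i,j)))" if "C \<subseteq> B" for C
      proof -
        have "finite C" using that B(2) finite_subset by blast
        then show ?thesis using that
        proof (induction C rule: finite_induct)
          case empty
          then show ?case by (simp add: W.lincomb_def module_mat_simps)
        next
          case (insert x C)
          have xW: "x \<in> W" "C \<subseteq> W" using insert.prems BW by auto
          have x: "x \<in> carrier_mat n n" using xW W by auto
          have "W.lincomb y (insert x C) = y x \<cdot>\<^sub>m x + W.lincomb y C"
            using W.lincomb_insert[where S = C and v = x and a = y] insert.hyps xW
            by (simp add: module_mat_simps)
          moreover have "W.lincomb y C \<in> carrier_mat n n"
            "\<And>i j. i < n \<Longrightarrow> j < n \<Longrightarrow> W.lincomb y C $$ (i,j) = (\<Sum>b\<in>C. y b * b $$ (i,j))"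
            using insert by auto
          ultimately show ?case using insert.hyps x by auto
        qed
      qed
      have "W.lincomb y B = 0\<^sub>m n n" using lc[of B] y by (intro eq_matI) auto
      then have "W.lin_dep B"
        unfolding W.lin_dep_def using B(2) b
        by (intro exI[of _ B] exI[of _ y] exI[of _ b]) (auto simp: module_mat_simps)
      with B(3) show False by simp
    qed
  qed
qed

lemma vec_subspace_dim_left_kernel:
  fixes A :: "'a :: field mat"
  assumes "A \<in> carrier_mat n n"
  shows "vec_subspace_dim n (left_kernel n A) = kernel_dim A\<^sup>T"
  using assms unfolding vec_subspace_dim_def left_kernel_eq_mat_kernel[OF assms] kernel_dim_def by simp

lemma transpose_pow_mat:
  fixes A :: "'a :: comm_semiring_1 mat"
  assumes "A \<in> carrier_mat n n"
  shows "(A ^\<^sub>m k)\<^sup>T = A\<^sup>T ^\<^sub>m k"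
proof (induction k)
  case (Suc k)
  have "A\<^sup>T ^\<^sub>m k * A\<^sup>T = A\<^sup>T * A\<^sup>T ^\<^sub>m k"
    using pow_mat_dim assms by (induction k) (auto simp: assoc_mult_mat[of _ n n _ n _ n])
  with Suc assms show ?case
    by (simp add: transpose_mult[of _ n n _ n] pow_carrier_mat)
qed (use assms in simp)

lemma kernel_dim_le: "kernel_dim A \<le> dim_col A"
  by (simp add: kernel_dim_code)

lemma kernel_dim_eq_0_if_left_inverse:
  fixes A :: "'a :: field mat"
  assumes A: "A \<in> carrier_mat n n" and B: "B \<in> carrier_mat n n" and "B * A = 1\<^sub>m n"
  shows "kernel_dim A = 0"
proof -
  have "mat_kernel A = mat_kernel (1\<^sub>m n)"
    using mat_kernel_mult_eq[OF one_carrier_mat A B assms(3)] A by simp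
  then show ?thesis using A kernel_one_mat(1)[where ?'a = 'a, of n] by (simp add: kernel_dim_def)
qed

section \<open>Jordan normal form over algebraically closed fields\<close>

lemma invertible_completion_of_vector:
  fixes v :: "'a :: field vec"
  assumes v: "v \<in> carrier_vec n" "v \<noteq> 0\<^sub>v n"
  obtains W W' where "W \<in> carrier_mat n n" "W' \<in> carrier_mat n n"
    "W * W' = 1\<^sub>m n" "W' * W = 1\<^sub>m n" "col W 0 = v"
proof -
  interpret vec_space "TYPE('a)" n .
  have n: "0 < n"
  proof (rule ccontr)
    assume "\<not> 0 < n"
    then have "v = 0\<^sub>v n" using v(1) by (intro eq_vecI) auto
    with v(2) show False by simp
  qed
  note b = basis_completion[OF v]
  define W where "W = mat_of_cols n (basis_completion v)"
  have W: "W \<in> carrier_mat n n" using mat_of_cols_carrier(1)[of n "basis_completion v"] b(6)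
    by (simp add: W_def)
  have cols: "cols W = basis_completion v" unfolding W_def by (rule cols_mat_of_cols[OF b(2)])
  have "rank W = n" using lin_indpt_full_rank[OF W] cols b(4,5) by simp
  then have "det W \<noteq> 0" using det_rank_iff[OF W] by simp
  then have "W \<in> Units (ring_mat TYPE('a) n ())" by (rule det_non_zero_imp_unit[OF W])
  then obtain W' where "W' \<in> carrier_mat n n" "W' * W = 1\<^sub>m n" "W * W' = 1\<^sub>m n"
    by (auto simp: Units_def ring_mat_simps)
  moreover have "col W 0 = v"
    using cols b(6,7) n W by (metis carrier_matD(2) cols_nth hd_conv_nth length_greater_0_conv)
  ultimately show ?thesis using W that by auto
qed

text \<open>
  Induction on the size: completing an eigenvector to a basis makes the first column of the conjugated
  matrix a multiple of the first unit vector, and the induction hypothesis applies to the remaining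
  lower right block. No inner product is involved, so the characteristic is arbitrary.
\<close>

theorem triangularizable:
  fixes A :: "'a :: alg_closed_field mat"
  assumes "A \<in> carrier_mat n n"
  shows "\<exists>B. upper_triangular B \<and> similar_mat A B"
  using assms
proof (induction n arbitrary: A)
  case 0
  then have "upper_triangular A" by auto
  with 0 show ?case using similar_mat_refl by blast
next
  case (Suc n)
  have "Polynomial.degree (char_poly A) > 0" using degree_monic_char_poly[OF Suc.prems] by simp
  then obtain e where "poly (char_poly A) e = 0" using alg_closed_imp_poly_has_root by blast
  then obtain v where v: "v \<in> carrier_vec (Suc n)" "v \<noteq> 0\<^sub>v (Suc n)" "A *\<^sub>v v = e \<cdot>\<^sub>v v"
    using eigenvalue_root_char_poly[OF Suc.prems] Suc.prems
    by (auto simp: eigenvalue_def eigenvector_def)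
  obtain W W' where W: "W \<in> carrier_mat (Suc n) (Suc n)" "W' \<in> carrier_mat (Suc n) (Suc n)"
    "W * W' = 1\<^sub>m (Suc n)" "W' * W = 1\<^sub>m (Suc n)" "col W 0 = v"
    by (rule invertible_completion_of_vector[OF v(1,2)])
  define A' where "A' = W' * A * W"
  have A': "A' \<in> carrier_mat (Suc n) (Suc n)" using W Suc.prems by (simp add: A'_def)
  have "similar_mat_wit A' A W' W"
    by (rule similar_mat_witI[OF W(4,3) A'_def A' Suc.prems W(2,1)])
  then have "similar_mat A' A" unfolding similar_mat_def by blast
  then have sim: "similar_mat A A'" by (rule similar_mat_sym)
  have "W' *\<^sub>v v = col (W' * W) 0" using W by (metis col_mult2 zero_less_Suc)
  then have W'v: "W' *\<^sub>v v = unit_vec (Suc n) 0" by (simp add: W(4))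
  have "col A' 0 = W' * A *\<^sub>v col W 0"
    unfolding A'_def using W Suc.prems by (intro col_mult2) auto
  also have "\<dots> = e \<cdot>\<^sub>v unit_vec (Suc n) 0"
    using W Suc.prems v by (simp add: assoc_mult_mat_vec[of _ "Suc n" "Suc n"] mult_mat_vec[of _ "Suc n" "Suc n"] W'v)
  finally have col: "col A' 0 = e \<cdot>\<^sub>v unit_vec (Suc n) 0" .
  obtain A1 A2 A0 A3 where split: "split_block A' 1 1 = (A1,A2,A0,A3)"
    by (cases "split_block A' 1 1") auto
  have blk: "A1 \<in> carrier_mat 1 1" "A2 \<in> carrier_mat 1 n" "A0 \<in> carrier_mat n 1"
    "A3 \<in> carrier_mat n n" "A' = four_block_mat A1 A2 A0 A3"
    using split_block[OF split, of n n] A' by auto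
  have "A' $$ (Suc i, 0) = 0" if "i < n" for i
    using arg_cong[OF col, of "\<lambda>u. vec_index u (Suc i)"] that A' by simp
  then have A0: "A0 = 0\<^sub>m n 1"
    using split A' by (intro eq_matI) (auto simp: split_block_def Let_def)
  from Suc.IH[OF blk(4)] obtain B where B: "upper_triangular B" "similar_mat A3 B" by auto
  then have Bc: "B \<in> carrier_mat n n" using blk(4) by (auto dest!: similar_matD)
  from similar_mat_four_block_0_ex[OF similar_mat_refl[OF blk(1)] B(2) blk(2,1,4)]
  obtain B0 where B0: "B0 \<in> carrier_mat 1 n"
    "similar_mat A' (four_block_mat A1 B0 (0\<^sub>m n 1) B)" using blk(5) A0 by auto
  have "upper_triangular (four_block_mat A1 B0 (0\<^sub>m n 1) B)"
    by (rule upper_triangular_four_block[OF blk(1) Bc _ B(1)]) (use blk(1) in auto)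
  with similar_mat_trans[OF sim B0(2)] show ?case by blast
qed

corollary jordan_nf_exists_alg_closed:
  fixes A :: "'a :: alg_closed_field mat"
  assumes "A \<in> carrier_mat n n"
  shows "\<exists>n_as. jordan_nf A n_as"
proof -
  obtain B where B: "upper_triangular B" "similar_mat A B"
    using triangularizable[OF assms] by blast
  then have "B \<in> carrier_mat n n" using assms by (auto dest!: similar_matD)
  from triangular_to_jnf_vector[OF this B(1)] B(2) show ?thesis
    unfolding jordan_nf_def by (blast intro: similar_mat_trans)
qed

lemma card_less_add_split:
  "card {i::nat. i < m + N \<and> P i} = card {i. i < m \<and> P i} + card {i. i < N \<and> P (m + i)}"
proof -
  have "{i. i < m + N \<and> P i} = {i. i < m \<and> P i} \<union> (+) m ` {i. i < N \<and> P (m + i)}"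
  proof (rule Set.set_eqI)
    fix i
    show "i \<in> {i. i < m + N \<and> P i} \<longleftrightarrow> i \<in> {i. i < m \<and> P i} \<union> (+) m ` {i. i < N \<and> P (m + i)}"
    proof (cases "i < m")
      case False
      then obtain k where "i = m + k" using le_Suc_ex not_less by blast
      then show ?thesis by (simp add: inj_image_mem_iff)
    qed auto
  qed
  moreover have "card ((+) m ` {i. i < N \<and> P (m + i)}) = card {i. i < N \<and> P (m + i)}"
    by (rule card_image) simp
  moreover have "{i. i < m \<and> P i} \<inter> (+) m ` {i. i < N \<and> P (m + i)} = {}" by auto
  ultimately show ?thesis by (simp add: card_Un_disjoint)
qed

text \<open>
  For the entrywise computations below, a Jordan matrix is described by its diagonal \<open>a\<close> and by the
  predicate \<open>l\<close>, where \<open>l j\<close> says that row \<open>j\<close> belongs to the same block as row \<open>j - 1\<close>. The rows with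
  \<open>\<not> l j\<close> are the first rows of the blocks, so counting them counts blocks.
\<close>

lemma jordan_matrix_entries:
  fixes n_as :: "(nat \<times> 'a :: field) list"
  assumes "0 \<notin> fst ` set n_as"
  defines "N \<equiv> sum_list (map fst n_as)"
  shows "\<exists>a l. \<not> l 0 \<and>
    (\<forall>i<N. \<forall>j<N. jordan_matrix n_as $$ (i,j) =
       (if i = j then a i else if j = Suc i \<and> l j then 1 else 0)) \<and>
    (\<forall>i. Suc i < N \<and> l (Suc i) \<longrightarrow> a (Suc i) = a i) \<and>
    (\<forall>x. card {i. i < N \<and> a i = x} = sum_list (map fst [(n, e)\<leftarrow>n_as. e = x])) \<and>
    (\<forall>x. card {i. i < N \<and> a i = x \<and> \<not> l i} = length [(n, e)\<leftarrow>n_as. e = x])"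
  using assms(1) unfolding N_def
proof (induction n_as)
  case Nil
  show ?case by (intro exI[of _ "\<lambda>_. 0"] exI[of _ "\<lambda>_. False"]) simp
next
  case (Cons nb n_as)
  obtain m b where nb: "nb = (m, b)" by force
  from Cons.prems nb have m: "m > 0" by auto
  let ?N = "sum_list (map fst n_as)" and ?J = "jordan_matrix n_as"
  from Cons obtain a l where l0: "\<not> l 0"
    and ent: "\<And>i j. i < ?N \<Longrightarrow> j < ?N \<Longrightarrow> ?J $$ (i,j) =
       (if i = j then a i else if j = Suc i \<and> l j then 1 else 0)"
    and link: "\<And>i. Suc i < ?N \<Longrightarrow> l (Suc i) \<Longrightarrow> a (Suc i) = a i"
    and cnt: "\<And>x. card {i. i < ?N \<and> a i = x} = sum_list (map fst [(n, e)\<leftarrow>n_as. e = x])"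
    and cntl: "\<And>x. card {i. i < ?N \<and> a i = x \<and> \<not> l i} = length [(n, e)\<leftarrow>n_as. e = x]"
    by auto
  define a' where "a' i = (if i < m then b else a (i - m))" for i
  define l' where "l' i = (if i < m then i > 0 else l (i - m))" for i
  have J: "jordan_matrix (nb # n_as) =
      four_block_mat (jordan_block m b) (0\<^sub>m m ?N) (0\<^sub>m ?N m) ?J"
    using jordan_matrix_dim[of n_as] unfolding nb jordan_matrix_def by (simp add: Let_def)
  have 1: "jordan_matrix (nb # n_as) $$ (i,j) =
       (if i = j then a' i else if j = Suc i \<and> l' j then 1 else 0)" if "i < m + ?N" "j < m + ?N" for i j
  proof -
    have "jordan_matrix (nb # n_as) $$ (i,j) =
        (if i < m then if j < m then jordan_block m b $$ (i,j) else 0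
         else if j < m then 0 else ?J $$ (i - m, j - m))"
      unfolding J using that by simp
    moreover have "\<not> l (j - m)" if "i < m" "\<not> j < m" "j = Suc i"
    proof -
      have "j - m = 0" using that by simp
      then show ?thesis using l0 by simp
    qed
    moreover have "j - m = Suc (i - m) \<longleftrightarrow> j = Suc i" "i - m = j - m \<longleftrightarrow> i = j"
      if "\<not> i < m" "\<not> j < m" using that by auto
    ultimately show ?thesis using that ent[of "i - m" "j - m"]
      by (cases "i < m"; cases "j < m") (simp_all add: a'_def l'_def)
  qed
  have 2: "a' (Suc i) = a' i" if "Suc i < m + ?N" "l' (Suc i)" for i
    using that link[of "i - m"] l0 by (auto simp: a'_def l'_def Suc_diff_le not_less le_Suc_eq)
  have 3: "card {i. i < m + ?N \<and> a' i = x} = sum_list (map fst [(n, e)\<leftarrow>nb # n_as. e = x])" for x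
  proof -
    have "{i. i < m \<and> a' i = x} = (if b = x then {..<m} else {})" by (auto simp: a'_def)
    then show ?thesis by (subst card_less_add_split) (auto simp: a'_def nb cnt)
  qed
  have 4: "card {i. i < m + ?N \<and> a' i = x \<and> \<not> l' i} = length [(n, e)\<leftarrow>nb # n_as. e = x]" for x
  proof -
    have "{i. i < m \<and> a' i = x \<and> \<not> l' i} = (if b = x then {0} else {})"
      using m by (auto simp: a'_def l'_def)
    then show ?thesis by (subst card_less_add_split) (auto simp: a'_def l'_def nb cntl)
  qed
  have 0: "\<not> l' 0" using m by (simp add: l'_def)
  show ?case
    by (rule exI[of _ a'], rule exI[of _ l']) (use 0 1 2 3 4 nb in auto)
qed

section \<open>Matrices that commute with a Jordan matrix up to a scalar\<close>

text \<open>
  The positions whose entries determine a matrix \<open>Y\<close> with \<open>Y J = c J Y\<close>, where \<open>J\<close> is given by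
  \<open>a\<close> and \<open>l\<close> as above. Between nilpotent blocks only the first row of each block is needed, since
  \<open>Y\<close> is an intertwiner of cyclic modules there. Between invertible blocks whose
  eigenvalues match, the whole rectangle is kept; this may overestimate the dimension but suffices.
\<close>

definition jordan_free_positions ::
    "nat \<Rightarrow> (nat \<Rightarrow> 'a :: field) \<Rightarrow> (nat \<Rightarrow> bool) \<Rightarrow> 'a \<Rightarrow> (nat \<times> nat) set" where
  "jordan_free_positions n a l c =
     {i. i < n \<and> a i = 0 \<and> \<not> l i} \<times> {j. j < n \<and> a j = 0} \<union>
     {(i, j). i < n \<and> j < n \<and> a i \<noteq> 0 \<and> a j = c * a i}"

text \<open>
  Comparing the entries at \<open>(i,j)\<close> gives
  \<open>(a j - c a i) Y(i,j) = c Y(i+1,j) - Y(i,j-1)\<close>, where the terms on the right are present only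
  if rows \<open>i, i+1\<close>, respectively columns \<open>j-1, j\<close>, lie in the same block. If \<open>a j \<noteq> c a i\<close>, then the
  same holds at the two neighbours, and \<open>Y\<close> vanishes by induction from the lower left corner of the
  rectangle. If \<open>a i = a j = 0\<close>, then the left side is zero and the relation carries zeros from one
  row of a block to the next.
\<close>

lemma jordan_skew_commuting_vanishes:
  fixes Y :: "'a :: field mat" and a :: "nat \<Rightarrow> 'a"
  assumes Y: "Y \<in> carrier_mat n n" and J: "J \<in> carrier_mat n n" and c: "c \<noteq> 0"
    and comm: "Y * J = c \<cdot>\<^sub>m (J * Y)"
    and l0: "\<not> l 0"
    and ent: "\<And>i j. i < n \<Longrightarrow> j < n \<Longrightarrow> J $$ (i,j) =
       (if i = j then a i else if j = Suc i \<and> l j then 1 else 0)"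
    and link: "\<And>i. Suc i < n \<Longrightarrow> l (Suc i) \<Longrightarrow> a (Suc i) = a i"
    and free: "\<And>i j. (i, j) \<in> jordan_free_positions n a l c \<Longrightarrow> Y $$ (i,j) = 0"
    and i: "i < n" and j: "j < n"
  shows "Y $$ (i,j) = 0"
proof -
  have rec: "(a j - c * a i) * Y $$ (i,j) =
      c * (if Suc i < n \<and> l (Suc i) then Y $$ (Suc i, j) else 0)
      - (if l j then Y $$ (i, j - 1) else 0)" if i: "i < n" and j: "j < n" for i j
  proof -
    have "(Y * J) $$ (i,j) = (\<Sum>k<n. Y $$ (i,k) * J $$ (k,j))"
      using i j Y J by (simp add: scalar_prod_def lessThan_atLeast0)
    also have "\<dots> = (\<Sum>k<n. (if k = j then Y $$ (i,j) * a j else 0) +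
        (if k = j - 1 then (if l j then Y $$ (i,j - 1) else 0) else 0))"
    proof (intro sum.cong refl)
      fix k assume "k \<in> {..<n}"
      then have k: "k < n" by simp
      show "Y $$ (i,k) * J $$ (k,j) = (if k = j then Y $$ (i,j) * a j else 0) +
        (if k = j - 1 then (if l j then Y $$ (i,j - 1) else 0) else 0)"
        unfolding ent[OF k j] using l0 by (cases j) auto
    qed
    also have "\<dots> = Y $$ (i,j) * a j + (if l j then Y $$ (i,j - 1) else 0)"
      using j by (auto simp: sum.distrib)
    finally have YJ: "(Y * J) $$ (i,j) = Y $$ (i,j) * a j + (if l j then Y $$ (i,j - 1) else 0)" .
    have "(J * Y) $$ (i,j) = (\<Sum>k<n. J $$ (i,k) * Y $$ (k,j))"
      using i j Y J by (simp add: scalar_prod_def lessThan_atLeast0)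
    also have "\<dots> = (\<Sum>k<n. (if k = i then a i * Y $$ (i,j) else 0) +
        (if k = Suc i then (if l (Suc i) then Y $$ (Suc i,j) else 0) else 0))"
      by (intro sum.cong refl) (auto simp: ent[OF i])
    also have "\<dots> = a i * Y $$ (i,j) + (if Suc i < n \<and> l (Suc i) then Y $$ (Suc i,j) else 0)"
      using i by (auto simp: sum.distrib)
    finally have JY: "(J * Y) $$ (i,j) = a i * Y $$ (i,j) +
      (if Suc i < n \<and> l (Suc i) then Y $$ (Suc i,j) else 0)" .
    have "(Y * J) $$ (i,j) = c * (J * Y) $$ (i,j)" using comm i j J Y by simp
    then show ?thesis unfolding YJ JY by (simp add: algebra_simps)
  qed
  consider "a j \<noteq> c * a i" | "a j = c * a i" "a i \<noteq> 0" | "a i = 0" "a j = 0" by force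
  then show ?thesis
  proof cases
    case 1
    then show ?thesis using i j
    proof (induction "(n - i) + j" arbitrary: i j rule: less_induct)
      case less
      have "Y $$ (Suc i, j) = 0" if "Suc i < n" "l (Suc i)"
        using less.prems that link[of i] by (intro less.hyps) auto
      moreover have "Y $$ (i, j - 1) = 0" if "l j"
        using less.prems that link[of "j - 1"] l0 by (cases j) (auto intro!: less.hyps)
      ultimately have "(a j - c * a i) * Y $$ (i,j) = 0"
        using rec[OF less.prems(2,3)] by auto
      then show ?case using less.prems(1) by simp
    qed
  next
    case 2
    then show ?thesis using i j by (intro free) (auto simp: jordan_free_positions_def)
  next
    case 3
    then show ?thesis using i j
    proof (induction i arbitrary: j)
      case 0
      then show ?case using l0 by (intro free) (auto simp: jordan_free_positions_def)
    next
      case (Suc i)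
      show ?case
      proof (cases "l (Suc i)")
        case False
        then show ?thesis using Suc.prems by (intro free) (auto simp: jordan_free_positions_def)
      next
        case True
        have ai: "a i = 0" using link[of i] True Suc.prems by simp
        have "Y $$ (i, j - 1) = 0" if "l j"
          using that link[of "j - 1"] l0 Suc.prems ai by (cases j) (auto intro!: Suc.IH)
        then have "c * Y $$ (Suc i, j) = 0"
          using rec[of i j] ai True Suc.prems by (auto split: if_splits)
        then show ?thesis using c by simp
      qed
    qed
  qed
qed


section \<open>Counting the free positions\<close>

text \<open>
  Let \<open>d x\<close> be the number of indices with value \<open>x\<close>. There are \<open>\<Sum> d x d (c x)\<close> pairs with
  \<open>a j = c a i\<close>. As multiplication by \<open>c\<close> is injective, the inequality
  \<open>2 p q \<le> p\<^sup>2 + q\<^sup>2\<close> shows that this is at most \<open>\<Sum> (d x)\<^sup>2\<close>, the number of pairs with \<open>a j = a i\<close>.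
  As \<open>c \<noteq> 1\<close> and all values are nonzero, no pair is counted twice, and together
  there are at most \<open>(card R)\<^sup>2\<close> pairs.
\<close>

lemma scaled_pairs_bound:
  fixes a :: "nat \<Rightarrow> 'a :: field"
  assumes "finite R" and nz: "\<And>i. i \<in> R \<Longrightarrow> a i \<noteq> 0" and c: "c \<notin> {0, 1}"
  shows "2 * card {(i, j). i \<in> R \<and> j \<in> R \<and> a j = c * a i} \<le> (card R)\<^sup>2"
proof -
  define d where "d x = card {i \<in> R. a i = x}" for x
  define T where "T = (\<lambda>c. {(i, j). i \<in> R \<and> j \<in> R \<and> a j = c * a i})"
  have fin: "finite (T c)" for c
    by (rule finite_subset[of _ "R \<times> R"]) (use assms(1) in \<open>auto simp: T_def\<close>)
  have card_T: "card (T c) = (\<Sum>x\<in>a ` R. d x * d (c * x))" for c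
  proof -
    have "T c = (\<Union>x\<in>a ` R. {i \<in> R. a i = x} \<times> {i \<in> R. a i = c * x})"
      by (auto simp: T_def)
    then have "card (T c) = (\<Sum>x\<in>a ` R. card ({i \<in> R. a i = x} \<times> {i \<in> R. a i = c * x}))"
      using assms(1) by (simp only:) (intro card_UN_disjoint; auto)
    then show ?thesis by (simp add: d_def card_cartesian_product)
  qed
  have d0: "d y = 0" if "y \<notin> a ` R" for y
  proof -
    have empty: "{i \<in> R. a i = y} = {}" using that by auto
    show ?thesis unfolding d_def empty by simp
  qed
  have shift: "(\<Sum>x\<in>a ` R. (d (c * x))\<^sup>2) \<le> (\<Sum>x\<in>a ` R. (d x)\<^sup>2)"
  proof -
    have "(\<Sum>x\<in>a ` R. (d (c * x))\<^sup>2) = (\<Sum>y\<in>(*) c ` a ` R. (d y)\<^sup>2)"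
      using c by (subst sum.reindex) (auto simp: inj_on_def)
    also have "\<dots> = (\<Sum>y\<in>(*) c ` a ` R \<inter> a ` R. (d y)\<^sup>2)"
      using assms(1) d0 by (intro sum.mono_neutral_right) auto
    also have "\<dots> \<le> (\<Sum>x\<in>a ` R. (d x)\<^sup>2)"
      using assms(1) by (intro sum_mono2) auto
    finally show ?thesis .
  qed
  have amgm: "2 * (p * q) \<le> p\<^sup>2 + q\<^sup>2" for p q :: nat
  proof -
    have "real (2 * (p * q)) \<le> real (p\<^sup>2 + q\<^sup>2)"
      using sum_squares_bound[of "real p" "real q"] by (simp add: mult.assoc)
    then show ?thesis by (simp only: of_nat_le_iff)
  qed
  have "2 * card (T c) \<le> (\<Sum>x\<in>a ` R. (d x)\<^sup>2 + (d (c * x))\<^sup>2)"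
    unfolding card_T sum_distrib_left by (intro sum_mono amgm)
  also have "\<dots> \<le> 2 * card (T 1)"
    using shift by (simp add: card_T sum.distrib power2_eq_square)
  finally have "card (T c) \<le> card (T 1)" by simp
  moreover have "T c \<inter> T 1 = {}" using nz c by (auto simp: T_def)
  then have "card (T c) + card (T 1) = card (T c \<union> T 1)"
    using fin by (subst card_Un_disjoint) auto
  moreover have "card (T c \<union> T 1) \<le> card (R \<times> R)"
    using assms(1) by (intro card_mono) (auto simp: T_def)
  ultimately show ?thesis by (simp add: T_def power2_eq_square card_cartesian_product)
qed

lemma card_jordan_free_positions:
  fixes a :: "nat \<Rightarrow> 'a :: field" and n :: nat
  assumes c: "c \<notin> {0, 1}"
  defines "m \<equiv> card {i. i < n \<and> a i = 0}"
  shows "real (card (jordan_free_positions n a l c)) \<le>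
     real (card {i. i < n \<and> a i = 0 \<and> \<not> l i}) * real m + (real n - real m)\<^sup>2 / 2"
proof -
  let ?S = "{i. i < n \<and> a i = 0 \<and> \<not> l i} \<times> {j. j < n \<and> a j = 0}"
  define R where "R = {i. i < n \<and> a i \<noteq> 0}"
  let ?T = "{(i, j). i \<in> R \<and> j \<in> R \<and> a j = c * a i}"
  have eq: "jordan_free_positions n a l c = ?S \<union> ?T"
    using c by (auto simp: jordan_free_positions_def R_def)
  have "card R + m = card (R \<union> {i. i < n \<and> a i = 0})"
    unfolding m_def by (subst card_Un_disjoint) (auto simp: R_def)
  also have "R \<union> {i. i < n \<and> a i = 0} = {..<n}" by (auto simp: R_def)
  finally have R: "real (card R) = real n - real m" by simp
  have "2 * card ?T \<le> (card R)\<^sup>2"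
    by (rule scaled_pairs_bound) (use c in \<open>auto simp: R_def\<close>)
  then have "real (2 * card ?T) \<le> real ((card R)\<^sup>2)" by (simp only: of_nat_le_iff)
  then have T: "real (card ?T) \<le> (real n - real m)\<^sup>2 / 2" by (simp add: R)
  have "card (jordan_free_positions n a l c) \<le> card ?S + card ?T"
    unfolding eq by (rule card_Un_le)
  then have "real (card (jordan_free_positions n a l c)) \<le> real (card ?S) + real (card ?T)"
    by (simp only: of_nat_add[symmetric] of_nat_le_iff)
  with T show ?thesis by (simp add: card_cartesian_product m_def)
qed

section \<open>The dimension of the skew centralizer\<close>

lemma triple_product_index:
  fixes L :: "'a :: comm_semiring_1 mat"
  assumes "L \<in> carrier_mat n n" "U \<in> carrier_mat n n" "R \<in> carrier_mat n n" "i < n" "j < n"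
  shows "(L * U * R) $$ (i,j) = (\<Sum>q<n. \<Sum>p<n. L $$ (i,p) * U $$ (p,q) * R $$ (q,j))"
  using assms
  by (simp add: scalar_prod_def lessThan_atLeast0 sum_distrib_right del: assoc_mult_mat)

text \<open>
  A linear combination of matrices is written entrywise, as the coefficients are indexed by a set and
  not by a list. Taking one of the outer factors to be the identity covers products with two factors.
\<close>

lemma triple_product_linear_combination:
  fixes L :: "'a :: comm_semiring_1 mat" and x :: "'b \<Rightarrow> 'a" and V :: "'b \<Rightarrow> 'a mat"
  assumes "L \<in> carrier_mat n n" "R \<in> carrier_mat n n" "\<And>b. b \<in> B \<Longrightarrow> V b \<in> carrier_mat n n"
    and "i < n" "j < n"
  defines "U \<equiv> mat n n (\<lambda>s. \<Sum>b\<in>B. x b * V b $$ s)"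
  shows "(L * U * R) $$ (i,j) = (\<Sum>b\<in>B. x b * (L * V b * R) $$ (i,j))"
proof -
  have "(L * U * R) $$ (i,j) =
      (\<Sum>q<n. \<Sum>p<n. \<Sum>b\<in>B. x b * (L $$ (i,p) * V b $$ (p,q) * R $$ (q,j)))"
    using assms
    by (subst triple_product_index[of _ n]) (auto simp: sum_distrib_left sum_distrib_right mult_ac)
  also have "\<dots> = (\<Sum>b\<in>B. \<Sum>q<n. \<Sum>p<n. x b * (L $$ (i,p) * V b $$ (p,q) * R $$ (q,j)))"
    by (subst (2) sum.swap, subst sum.swap) simp
  also have "\<dots> = (\<Sum>b\<in>B. x b * (L * V b * R) $$ (i,j))"
    using assms by (intro sum.cong refl) (simp add: triple_product_index[of _ n] sum_distrib_left del: index_mult_mat)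
  finally show ?thesis .
qed

text \<open>
  Conjugation carries the solutions of the equation for \<open>M\<close> to those for the similar matrix \<open>J\<close>, and
  it can be undone.
\<close>

lemma skew_commuting_similar:
  fixes M :: "'a :: field mat"
  assumes M: "M \<in> carrier_mat n n" and sim: "similar_mat_wit M J P Q"
    and V: "V \<in> carrier_mat n n" and comm: "V * M = c \<cdot>\<^sub>m (M * V)"
  shows "(Q * V * P) * J = c \<cdot>\<^sub>m (J * (Q * V * P))" and "P * (Q * V * P) * Q = V"
proof -
  note w = similar_mat_witD2[OF M sim]
  note w' = similar_mat_witD2[OF w(5) similar_mat_wit_sym[OF sim]]
  note assoc = assoc_mult_mat[of _ n n _ n _ n]
  have PQ: "P * (Q * G) = G" if "G \<in> carrier_mat n n" for G
    unfolding assoc_mult_mat[symmetric, OF w(6,7) that] w(1) using that by simp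
  have MV: "M * V \<in> carrier_mat n n" using M V by simp
  have "(Q * V * P) * J = Q * (V * M) * P"
    using V M w by (subst w'(3)) (simp add: assoc PQ)
  also have "\<dots> = c \<cdot>\<^sub>m (Q * (M * V) * P)"
    unfolding comm mult_smult_distrib[OF w(7) MV]
      mult_smult_assoc_mat[OF mult_carrier_mat[OF w(7) MV] w(6)] ..
  also have "Q * (M * V) * P = J * (Q * V * P)"
    using V M w by (subst w'(3)) (simp add: assoc PQ)
  finally show "(Q * V * P) * J = c \<cdot>\<^sub>m (J * (Q * V * P))" .
  have "P * (Q * V * P) * Q = V * (P * Q)" using V w by (simp add: assoc PQ)
  then show "P * (Q * V * P) * Q = V" using V w by simp
qed

interpretation to_ac: field_hom "to_ac :: 'a :: field \<Rightarrow> 'a alg_closure"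
  by unfold_locales auto

lemma sum_list_min_1: "\<forall>k\<in>set ks. k > 0 \<Longrightarrow> (\<Sum>k\<leftarrow>ks. min 1 k) = length ks" for ks :: "nat list"
  by (induction ks) auto

lemma sum_list_min_bound: "\<forall>k\<in>set ks. k \<le> n \<Longrightarrow> (\<Sum>k\<leftarrow>ks. min n k) = sum_list ks" for ks :: "nat list"
  by (induction ks) auto

text \<open>
  The first summand comes from the nilpotent part of \<open>A\<close>, the second from its invertible part. The right
  hand side is at most \<open>n\<^sup>2 / 2\<close> exactly if \<open>m = 0\<close> or \<open>k + m / 2 \<le> n\<close>. The proof uses the
  Jordan form of the transpose because \<open>k\<close> and \<open>m\<close> measure kernels of the action on row vectors.
\<close>

theorem skew_centralizer_dim_bound:
  fixes A :: "'a :: field mat"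
  assumes A: "A \<in> carrier_mat n n" and c: "c \<notin> {0, 1}"
  defines "k \<equiv> vec_subspace_dim n (left_kernel n A)"
    and "m \<equiv> vec_subspace_dim n (left_kernel n (A ^\<^sub>m n))"
  shows "real (mat_subspace_dim n (skew_centralizer n A c)) \<le>
    real k * real m + (real n - real m)\<^sup>2 / 2"
proof -
  define M where "M = map_mat to_ac A\<^sup>T"
  define d where "d = to_ac c"
  have M: "M \<in> carrier_mat n n" using A by (simp add: M_def)
  have d: "d \<notin> {0, 1}" using c by (simp add: d_def)
  obtain n_as where jnf: "jordan_nf M n_as" using jordan_nf_exists_alg_closed[OF M] by blast
  define J where "J = jordan_matrix n_as"
  obtain P Q where sim: "similar_mat_wit M J P Q" and pos: "0 \<notin> fst ` set n_as"
    using jnf by (auto simp: jordan_nf_def similar_mat_def J_def)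
  note w = similar_mat_witD2[OF M sim]
  have N: "sum_list (map fst n_as) = n"
    using carrier_matD(1)[OF w(5)] by (simp add: J_def)
  obtain a l where l0: "\<not> l 0"
    and ent: "\<And>i j. i < n \<Longrightarrow> j < n \<Longrightarrow> J $$ (i,j) =
       (if i = j then a i else if j = Suc i \<and> l j then 1 else 0)"
    and link: "\<And>i. Suc i < n \<Longrightarrow> l (Suc i) \<Longrightarrow> a (Suc i) = a i"
    and cnt: "\<And>x. card {i. i < n \<and> a i = x} = sum_list (map fst [(n, e)\<leftarrow>n_as. e = x])"
    and cntl: "\<And>x. card {i. i < n \<and> a i = x \<and> \<not> l i} = length [(n, e)\<leftarrow>n_as. e = x]"
    using jordan_matrix_entries[OF pos] unfolding N J_def by blast
  let ?ks = "map fst [(n, e)\<leftarrow>n_as. e = 0]"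
  have char: "char_matrix M 0 = M" using M by (intro eq_matI) (auto simp: char_matrix_def)
  have ks: "\<forall>k\<in>set ?ks. k > 0" "\<forall>k\<in>set ?ks. k \<le> n"
    using pos member_le_sum_list[of _ "map fst n_as"] unfolding N by force+
  have "k = kernel_dim M"
    unfolding k_def M_def to_ac.kernel_dim_map_mat by (rule vec_subspace_dim_left_kernel[OF A])
  also have "\<dots> = dim_gen_eigenspace M 0 1"
    using M by (simp add: dim_gen_eigenspace_def char)
  also have "\<dots> = card {i. i < n \<and> a i = 0 \<and> \<not> l i}"
    unfolding dim_gen_eigenspace[OF jnf] cntl sum_list_min_1[OF ks(1)] by simp
  finally have k: "k = card {i. i < n \<and> a i = 0 \<and> \<not> l i}" .
  have "m = kernel_dim (A\<^sup>T ^\<^sub>m n)"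
    unfolding m_def using A by (simp add: vec_subspace_dim_left_kernel transpose_pow_mat)
  also have "\<dots> = kernel_dim (map_mat to_ac (A\<^sup>T ^\<^sub>m n))" by (simp add: to_ac.kernel_dim_map_mat)
  also have "\<dots> = dim_gen_eigenspace M 0 n"
    unfolding dim_gen_eigenspace_def char unfolding M_def
    using A by (simp add: to_ac.mat_hom_pow[of _ n])
  also have "\<dots> = card {i. i < n \<and> a i = 0}"
    unfolding dim_gen_eigenspace[OF jnf] cnt sum_list_min_bound[OF ks(2)] ..
  finally have m: "m = card {i. i < n \<and> a i = 0}" .
  define S where "S = jordan_free_positions n a l d"
  have S: "S \<subseteq> {..<n} \<times> {..<n}" by (auto simp: S_def jordan_free_positions_def)
  then have finS: "finite S" by (rule finite_subset) simp
  have "mat_subspace_dim n (skew_centralizer n A c) \<le> card S"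
  proof (rule mat_subspace_dim_le[OF skew_centralizer_subspace[OF A]], rule ccontr)
    fix B assume B: "finite B" "B \<subseteq> skew_centralizer n A c" "\<not> card B \<le> card S"
      and indep: "\<And>y. \<forall>i<n. \<forall>j<n. (\<Sum>b\<in>B. y b * b $$ (i,j)) = 0 \<Longrightarrow> \<forall>b\<in>B. y b = 0"
    define V where "V b = map_mat to_ac (b\<^sup>T)" for b :: "'a mat"
    define G where "G b = Q * V b * P" for b
    have V: "V b \<in> carrier_mat n n" "V b * M = d \<cdot>\<^sub>m (M * V b)" if "b \<in> B" for b
    proof -
      have b: "b \<in> carrier_mat n n" and eq: "A * b - c \<cdot>\<^sub>m (b * A) = 0\<^sub>m n n"
        using that B(2) by (auto simp: skew_centralizer_def)
      have "A * b = c \<cdot>\<^sub>m (b * A)"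
      proof (rule eq_matI)
        fix i j assume "i < dim_row (c \<cdot>\<^sub>m (b * A))" "j < dim_col (c \<cdot>\<^sub>m (b * A))"
        then show "(A * b) $$ (i,j) = (c \<cdot>\<^sub>m (b * A)) $$ (i,j)"
          using arg_cong[OF eq, of "\<lambda>Z. Z $$ (i,j)"] A b by simp
      qed (use A b in auto)
      moreover have "(c \<cdot>\<^sub>m (b * A))\<^sup>T = c \<cdot>\<^sub>m (b * A)\<^sup>T" by (intro eq_matI) auto
      ultimately have "(A * b)\<^sup>T = c \<cdot>\<^sub>m (b * A)\<^sup>T" by simp
      then have "b\<^sup>T * A\<^sup>T = c \<cdot>\<^sub>m (A\<^sup>T * b\<^sup>T)" using A b by (simp add: transpose_mult[of _ n n _ n])
      then have "map_mat to_ac (b\<^sup>T * A\<^sup>T) = map_mat to_ac (c \<cdot>\<^sub>m (A\<^sup>T * b\<^sup>T))" by simp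
      also have "\<dots> = d \<cdot>\<^sub>m map_mat to_ac (A\<^sup>T * b\<^sup>T)" by (intro eq_matI) (auto simp: d_def)
      finally show "V b * M = d \<cdot>\<^sub>m (M * V b)"
        using A b by (simp add: V_def M_def to_ac.mat_hom_mult[of _ n n _ n])
      show "V b \<in> carrier_mat n n" using b by (simp add: V_def)
    qed
    note G = skew_commuting_similar[OF M sim V, folded G_def]
    have Gc: "G b \<in> carrier_mat n n" if "b \<in> B" for b using V(1)[OF that] w by (simp add: G_def)
    (* Too many matrices for the free positions: some combination over the closure vanishes there. *)
    obtain x p where p: "p \<in> B" "x p \<noteq> 0" and x: "\<And>s. s \<in> S \<Longrightarrow> (\<Sum>b\<in>B. x b * G b $$ s) = 0"
      using underdetermined_system_nontrivial_solution[OF finS B(1), of "\<lambda>b s. G b $$ s"] B(3) by auto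
    define Y where "Y = mat n n (\<lambda>s. \<Sum>b\<in>B. x b * G b $$ s)"
    have Y: "Y \<in> carrier_mat n n" by (simp add: Y_def)
    have lin: "(L * Y * R) $$ (i,j) = (\<Sum>b\<in>B. x b * (L * G b * R) $$ (i,j))"
      if "L \<in> carrier_mat n n" "R \<in> carrier_mat n n" "i < n" "j < n" for L R i j
      unfolding Y_def using that Gc by (intro triple_product_linear_combination) auto
    have YJ: "Y * J = d \<cdot>\<^sub>m (J * Y)"
    proof (rule eq_matI)
      fix i j assume "i < dim_row (d \<cdot>\<^sub>m (J * Y))" "j < dim_col (d \<cdot>\<^sub>m (J * Y))"
      then have ij: "i < n" "j < n" using w Y by auto
      have "(Y * J) $$ (i,j) = (1\<^sub>m n * Y * J) $$ (i,j)" using Y by simp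
      also have "\<dots> = (\<Sum>b\<in>B. x b * (1\<^sub>m n * G b * J) $$ (i,j))"
        using w ij by (intro lin) auto
      also have "\<dots> = (\<Sum>b\<in>B. d * (x b * (J * G b * 1\<^sub>m n) $$ (i,j)))"
      proof (intro sum.cong refl)
        fix b assume b: "b \<in> B"
        have "1\<^sub>m n * G b * J = d \<cdot>\<^sub>m (J * G b)" using G(1)[OF b b] Gc[OF b] by simp
        moreover have "J * G b * 1\<^sub>m n = J * G b" using Gc[OF b] w by simp
        ultimately show "x b * (1\<^sub>m n * G b * J) $$ (i,j) = d * (x b * (J * G b * 1\<^sub>m n) $$ (i,j))"
          using ij Gc[OF b] w by simp
      qed
      also have "\<dots> = d * (J * Y * 1\<^sub>m n) $$ (i,j)"
        using w ij by (subst lin) (auto simp: sum_distrib_left)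
      also have "\<dots> = (d \<cdot>\<^sub>m (J * Y)) $$ (i,j)" using w Y ij by simp
      finally show "(Y * J) $$ (i,j) = (d \<cdot>\<^sub>m (J * Y)) $$ (i,j)" .
    qed (use w Y in auto)
    have "Y $$ (i,j) = 0" if "i < n" "j < n" for i j
    proof (rule jordan_skew_commuting_vanishes[OF Y w(5) _ YJ l0 ent link _ that])
      fix i j assume ij: "(i, j) \<in> jordan_free_positions n a l d"
      then have "(i, j) \<in> S" "i < n" "j < n" using S by (auto simp: S_def)
      with x show "Y $$ (i,j) = 0" by (simp add: Y_def)
    qed (use d in auto)
    then have Y0: "Y = 0\<^sub>m n n" using Y by (intro eq_matI) auto
    (* Conjugating back, the vanishing of Y is a linear relation over the closure between the
       elements of B. *)
    have "(\<Sum>b\<in>B. x b * to_ac (b $$ (i,j))) = 0" if ij: "i < n" "j < n" for i j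
    proof -
      have "(\<Sum>b\<in>B. x b * to_ac (b $$ (i,j))) = (\<Sum>b\<in>B. x b * (P * G b * Q) $$ (j,i))"
      proof (intro sum.cong refl)
        fix b assume b: "b \<in> B"
        have "b \<in> carrier_mat n n" using b B(2) by (auto simp: skew_centralizer_def)
        then show "x b * to_ac (b $$ (i,j)) = x b * (P * G b * Q) $$ (j,i)"
          unfolding G(2)[OF b b] using ij by (simp add: V_def)
      qed
      also have "\<dots> = (P * Y * Q) $$ (j,i)" using w ij by (simp only: lin)
      also have "\<dots> = 0" using w ij by (simp add: Y0)
      finally show ?thesis .
    qed
    then obtain y where "y p \<noteq> 0" "\<forall>s\<in>{..<n} \<times> {..<n}. (\<Sum>b\<in>B. y b * b $$ s) = 0"
      using to_ac.linear_dependence_descends[where S = "{..<n} \<times> {..<n}" and g = "\<lambda>b s. b $$ s" and x = x, OF _ p]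
      by auto
    with indep[of y] p show False by auto
  qed
  then have "real (mat_subspace_dim n (skew_centralizer n A c)) \<le> real (card S)" by simp
  also have "\<dots> \<le> real k * real m + (real n - real m)\<^sup>2 / 2"
    unfolding S_def k m by (rule card_jordan_free_positions[OF d])
  finally show ?thesis .
qed

theorem theorem6p2:
  fixes A :: "'a :: field mat" and c :: 'a and n k\<^sub>0 m\<^sub>0 :: nat
  assumes "A \<in> carrier_mat n n"
    and "c \<notin> {0, 1}"
    and "k\<^sub>0 = vec_subspace_dim n (left_kernel n A)"
    and "m\<^sub>0 = vec_subspace_dim n (left_kernel n (A ^\<^sub>m n))"
  shows "(real k\<^sub>0 + real m\<^sub>0 / 2 \<le> real n \<longrightarrow>
            real (mat_subspace_dim n (skew_centralizer n A c)) \<le> (real n)\<^sup>2 / 2) \<and>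
         (invertible_mat A \<longrightarrow>
            real (mat_subspace_dim n (skew_centralizer n A c)) \<le> (real n)\<^sup>2 / 2)"
proof -
  let ?D = "real (mat_subspace_dim n (skew_centralizer n A c))"
  have bound: "?D \<le> (real n)\<^sup>2 / 2" if "real k\<^sub>0 + real m\<^sub>0 / 2 \<le> real n"
  proof -
    have "real k\<^sub>0 * real m\<^sub>0 \<le> (real n - real m\<^sub>0 / 2) * real m\<^sub>0"
      using that by (intro mult_right_mono) auto
    moreover have "?D \<le> real k\<^sub>0 * real m\<^sub>0 + (real n - real m\<^sub>0)\<^sup>2 / 2"
      unfolding assms(3,4) by (rule skew_centralizer_dim_bound[OF assms(1,2)])
    moreover have "(real n - real m\<^sub>0 / 2) * real m\<^sub>0 + (real n - real m\<^sub>0)\<^sup>2 / 2 = (real n)\<^sup>2 / 2"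
      by (simp add: power2_eq_square field_simps)
    ultimately show ?thesis by linarith
  qed
  moreover have "?D \<le> (real n)\<^sup>2 / 2" if inv: "invertible_mat A"
  proof (rule bound)
    obtain B where B: "A * B = 1\<^sub>m n" "B * A = 1\<^sub>m (dim_row B)"
      using inv assms(1) by (auto simp: invertible_mat_def inverts_mat_def)
    then have Bc: "B \<in> carrier_mat n n"
      using assms(1) by (metis carrier_matD(2) carrier_matI index_mult_mat(2,3) index_one_mat(2,3))
    have "B\<^sup>T * A\<^sup>T = 1\<^sub>m n"
      using B(1) assms(1) Bc by (simp flip: transpose_mult[of _ n n _ n])
    then have "k\<^sub>0 = 0"
      unfolding assms(3) vec_subspace_dim_left_kernel[OF assms(1)]
      using assms(1) Bc by (intro kernel_dim_eq_0_if_left_inverse[of _ n "B\<^sup>T"]) auto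
    moreover have "m\<^sub>0 \<le> n"
      using kernel_dim_le[of "(A ^\<^sub>m n)\<^sup>T"] assms(1) by (simp add: assms(4) vec_subspace_dim_left_kernel)
    ultimately show "real k\<^sub>0 + real m\<^sub>0 / 2 \<le> real n" by simp
  qed
  ultimately show ?thesis by blast
qed

end
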